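(* Let $0<p\le 1$ and let $E$ and $F$ be real $p$-normed spaces. Let $T:E\to F$ be a continuous map with $T(0)=0$ which preserves equality of distance and satisfies $$2T(x)-T(y)\in T(E)\quad\text{for all } x,y\in E.$$ Then: (i) $T$ is linear; (ii) $T=\beta V$, where $\beta$ is a real number and $V$ is an isometry from $E$ to $F$.
   Context: All linear spaces are over $\mathbb{R}$. For $0<p\le 1$, a $p$-normed space is a linear space $E$ with a function $\|\cdot\|:E\to[0,\infty)$ such that $\|x\|=0$ iff $x=0$, $\|ax\|=|a|^p\|x\|$ for all scalars $a$ and all $x\in E$, and $\|x+y\|\le\|x\|+\|y\|$ for all $x,y\in E$; it carries the metric $d(x,y)=\|x-y\|$, and continuity is with respect to this metric. A map $T:E\to F$ preserves equality of distance if there exists a function $\phi:[0,\infty)\to[0,\infty)$ such that $\|Tx-Ty\|=\phi(\|x-y\|)$ for all $x,y\in E$. An isometry from $E$ to $F$ is a map $V:E\to F$ (not necessarily surjective) with $\|Vx-Vy\|=\|x-y\|$ for all $x,y\in E$.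
   Formalization: Part (ii) is asserted only for T not identically zero: for T = 0 it can fail, e.g. p = 1, E = ℝ, F = {0}, where no isometry from E to F exists; part (i) is proved without restriction. *)

theory Defs
  imports "HOL-Analysis.Abstract_Metric_Spaces"
begin

locale p_normed_space =
  fixes p :: real and N :: "'a::real_vector \<Rightarrow> real"
  assumes p_pos: "0 < p" and p_le_1: "p \<le> 1"
    and nonneg: "N x \<ge> 0"
    and eq_zero_iff: "N x = 0 \<longleftrightarrow> x = 0"
    and scale: "N (a *\<^sub>R x) = \<bar>a\<bar> powr p * N x"
    and triangle: "N (x + y) \<le> N x + N y"

definition norm_dist :: "('a::real_vector \<Rightarrow> real) \<Rightarrow> 'a \<Rightarrow> 'a \<Rightarrow> real" where
  "norm_dist N x y = N (x - y)"

lemma (in p_normed_space) Metric_space_norm_dist: "Metric_space UNIV (norm_dist N)"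
proof
  fix x y z :: 'a
  show "0 \<le> norm_dist N x y"
    by (simp add: norm_dist_def nonneg)
  show "norm_dist N x y = norm_dist N y x"
    using scale[of "-1" "x - y"] by (simp add: norm_dist_def)
  show "norm_dist N x y = 0 \<longleftrightarrow> x = y"
    by (simp add: norm_dist_def eq_zero_iff)
  show "norm_dist N x z \<le> norm_dist N x y + norm_dist N y z"
    using triangle[of "x - y" "y - z"] by (simp add: norm_dist_def)
qed

definition norm_topology :: "('a::real_vector \<Rightarrow> real) \<Rightarrow> 'a topology" where
  "norm_topology N = Metric_space.mtopology UNIV (norm_dist N)"

(* phi is a function from [0, infinity) to itself; its values at negative arguments are irrelevant. *)
definition preserves_equality_of_distance ::
    "('a::real_vector \<Rightarrow> real) \<Rightarrow> ('b::real_vector \<Rightarrow> real) \<Rightarrow> ('a \<Rightarrow> 'b) \<Rightarrow> bool" where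
  "preserves_equality_of_distance NE NF T \<longleftrightarrow>
     (\<exists>\<phi>::real \<Rightarrow> real. (\<forall>t\<ge>0. \<phi> t \<ge> 0) \<and> (\<forall>x y. NF (T x - T y) = \<phi> (NE (x - y))))"

(* Neither surjectivity nor linearity is required. In particular an isometry from E to F need not
   exist, so the zero map is in general not of the form "scalar times isometry". *)
definition is_isometry ::
    "('a::real_vector \<Rightarrow> real) \<Rightarrow> ('b::real_vector \<Rightarrow> real) \<Rightarrow> ('a \<Rightarrow> 'b) \<Rightarrow> bool" where
  "is_isometry NE NF V \<longleftrightarrow> (\<forall>x y. NF (V x - V y) = NE (x - y))"

end

theory Submission imports Defs begin

text \<open>
  The set \<open>T(E)\<close> is invariant under the point reflections of \<open>F\<close> at its own points, so it contains
  unbounded arithmetic progressions unless \<open>T = 0\<close>. If \<open>T\<close> were not injective, it would have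
  periods in every direction and hence be bounded; so a nonzero \<open>T\<close> is injective. Give \<open>E\<close> the
  metric \<open>d(x,y) = \<parallel>T x - T y\<parallel>\<close>. Both the point reflections of \<open>E\<close> and the pulled-back point
  reflections of \<open>F\<close> are bijective isometries for \<open>d\<close>, and a reflection of the second kind moves
  \<open>x\<close> by \<open>2\<^sup>p d(x,c)\<close>, where \<open>c\<close> is its centre. Vaisala's proof of the Mazur-Ulam theorem then
  shows that the \<open>E\<close>-reflection exchanging \<open>x\<close> with its \<open>F\<close>-reflection at \<open>c\<close> fixes \<open>c\<close>. Hence
  \<open>T (2c - x) = 2 T c - T x\<close>, so \<open>T\<close> is additive.
\<close>

section \<open>Growth and scaling estimates for p-norms\<close>

lemma nat_powr_mult_bounded_imp_nonpos:
  fixes p c B :: real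
  assumes "0 < p" and bound: "\<And>n::nat. real n powr p * c \<le> B"
  shows "c \<le> 0"
proof (rule ccontr)
  assume "\<not> c \<le> 0"
  then have c: "c > 0" by simp
  \<comment> \<open>The maximum keeps \<open>b\<close> positive, and the summand 1 makes
    \<open>b * c\<close> exceed \<open>B\<close>.\<close>
  define b where "b = max B 0 / c + 1"
  have b: "b > 0" using c by (simp add: b_def add_nonneg_pos)
  obtain n :: nat where n: "b powr (1/p) < real n"
    using reals_Archimedean2 by blast
  have "b = (b powr (1/p)) powr p"
    using b assms(1) by (simp add: powr_powr)
  also have "\<dots> \<le> real n powr p"
    using n assms(1) by (intro powr_mono2) auto
  finally have "b * c \<le> B"
    using bound[of n] c by (meson dual_order.trans less_imp_le mult_right_mono)
  moreover have "b * c = max B 0 + c"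
    using c by (simp add: b_def field_simps)
  ultimately show False using c by simp
qed

context p_normed_space
begin

lemma zero: "N 0 = 0"
  by (simp add: eq_zero_iff)

lemma minus: "N (- x) = N x"
  using scale[of "-1" x] by simp

lemma diff_commute: "N (x - y) = N (y - x)"
  using minus[of "x - y"] by simp

lemma exists_rescaling:
  assumes "x \<noteq> 0" "t \<ge> 0"
  obtains s where "s \<ge> 0" "s powr p = t / N x" "N (s *\<^sub>R x) = t"
proof -
  have pos: "N x > 0" using assms(1) nonneg eq_zero_iff by (metis less_eq_real_def)
  define s where "s = (t / N x) powr (1/p)"
  have s: "s powr p = t / N x"
    using assms pos p_pos by (simp add: s_def powr_powr)
  moreover have "s \<ge> 0" by (simp add: s_def)
  ultimately have "N (s *\<^sub>R x) = t" using pos by (simp add: scale)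
  with s \<open>s \<ge> 0\<close> that show thesis by blast
qed

text \<open>Division by \<open>n\<close> divides \<open>N\<close> by \<open>n powr p\<close>, so one
  \<open>n\<close> with \<open>n powr p\<close> above \<open>r / \<delta>\<close> serves the whole
  ball.\<close>

lemma exists_small_fraction:
  assumes "\<delta> > 0"
  obtains n :: nat where "n > 0" "\<And>x. N x \<le> r \<Longrightarrow> N ((1 / real n) *\<^sub>R x) < \<delta>"
proof -
  define b where "b = (max r 0 / \<delta>) powr (1/p)"
  obtain n :: nat where n: "b < real n" using reals_Archimedean2 by blast
  have n0: "real n > 0" using n powr_ge_zero[of "max r 0 / \<delta>" "1/p"] by (simp only: b_def)
  have "max r 0 / \<delta> = b powr p"
    using assms p_pos by (simp add: b_def powr_powr)
  also have "\<dots> < real n powr p"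
    using n p_pos by (intro powr_less_mono2) (auto simp: b_def)
  finally have *: "max r 0 < \<delta> * real n powr p"
    using assms by (simp add: field_simps)
  have "N ((1 / real n) *\<^sub>R x) < \<delta>" if "N x \<le> r" for x
  proof -
    have "N ((1 / real n) *\<^sub>R x) = N x / real n powr p"
      using n0 by (simp add: scale powr_divide)
    also have "\<dots> < \<delta>"
      using * that n0 by (simp add: divide_less_eq)
    finally show ?thesis .
  qed
  with that n0 show thesis by simp
qed

end

section \<open>Metric tools: continuity at a point and reflection centres\<close>

lemma (in Metric_space) continuous_at_pointD:
  assumes "Metric_space UNIV d'"
    and "continuous_map mtopology (Metric_space.mtopology UNIV d') f"
    and "x \<in> M" "e > 0"
  obtains \<delta> where "\<delta> > 0" "\<And>y. y \<in> M \<Longrightarrow> d x y < \<delta> \<Longrightarrow> d' (f x) (f y) < e"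
proof -
  interpret B: Metric_space UNIV d' by fact
  have "openin mtopology {y \<in> topspace mtopology. f y \<in> B.mball (f x) e}"
    using assms(2) openin_continuous_map_preimage by blast
  moreover have "x \<in> {y \<in> topspace mtopology. f y \<in> B.mball (f x) e}"
    using assms(3,4) by simp
  ultimately obtain \<delta> where "\<delta> > 0" "mball x \<delta> \<subseteq> {y \<in> topspace mtopology. f y \<in> B.mball (f x) e}"
    unfolding openin_mtopology by meson
  with assms(3) show thesis by (intro that[of \<delta>]) (auto simp: subset_iff)
qed

text \<open>
  Vaisala's argument: replacing \<open>g\<close> by \<open>\<psi> \<circ> g\<^sup>-\<^sup>1 \<circ> \<psi> \<circ> g\<close> multiplies the displacement of \<open>z\<close>
  by \<open>k\<close>, while all displacements are bounded by \<open>2 d(a,z)\<close>.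
\<close>
lemma isometry_fixes_reflection_centre:
  fixes d :: "'a \<Rightarrow> 'a \<Rightarrow> real"
  assumes "Metric_space UNIV d"
    and \<psi>: "bij \<psi>" "\<And>x y. d (\<psi> x) (\<psi> y) = d x y" "\<psi> z = z" "\<psi> ` {a, b} = {a, b}"
    and eq: "d a z = d b z"
    and k: "k > 1" "\<And>x. d (\<psi> x) x = k * d x z"
    and g: "bij g" "\<And>x y. d (g x) (g y) = d x y" "g ` {a, b} = {a, b}"
  shows "g z = z"
proof -
  interpret Metric_space UNIV d by fact
  define W where "W = {g. bij g \<and> (\<forall>x y. d (g x) (g y) = d x y) \<and> g ` {a, b} = {a, b}}"
  \<comment> \<open>\<open>g a\<close> is \<open>a\<close> or \<open>b\<close>, both at distance
    \<open>d a z\<close> from \<open>z\<close>, so the path through \<open>g a\<close> has length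
    \<open>2 * d a z\<close>.\<close>
  have bounded: "d (g z) z \<le> 2 * d a z" if "g \<in> W" for g
  proof -
    have "g a \<in> {a, b}" using that by (auto simp: W_def)
    then have "d (g a) z = d a z" using eq by auto
    moreover have "d (g z) (g a) = d a z" using that by (simp add: W_def commute)
    ultimately show ?thesis using triangle[of "g z" "g a" z] by simp
  qed
  have step: "\<exists>h\<in>W. d (h z) z = k * d (g z) z" if "g \<in> W" for g
  proof
    have bij: "bij g" and iso: "\<And>x y. d (g x) (g y) = d x y" and img: "g ` {a, b} = {a, b}"
      using that by (auto simp: W_def)
    have g_inv: "g (inv g x) = x" for x using bij by (simp add: bij_is_surj surj_f_inv_f)
    have inv_iso: "d (inv g x) (inv g y) = d x y" for x y
      by (metis g_inv iso)
    have inv_img: "inv g ` {a, b} = {a, b}"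
      by (metis bij bij_is_inj image_inv_f_f img)
    define h where "h = \<psi> \<circ> inv g \<circ> \<psi> \<circ> g"
    have "bij h" unfolding h_def
      by (intro bij_comp bij bij_imp_bij_inv \<psi>(1))
    moreover have "d (h x) (h y) = d x y" for x y
      by (simp add: h_def \<psi>(2) inv_iso iso)
    moreover have "h ` {a, b} = {a, b}"
      unfolding h_def image_comp[symmetric] img \<psi>(4) inv_img ..
    ultimately show "h \<in> W" by (simp add: W_def)
    \<comment> \<open>The outer \<open>\<psi>\<close> fixes \<open>z\<close> and drops out; applying
      \<open>g\<close> to both points leaves the displacement of \<open>g z\<close> under
      \<open>\<psi>\<close>.\<close>
    have "d (h z) z = d (inv g (\<psi> (g z))) z"
      using \<psi>(2)[of "inv g (\<psi> (g z))" z] by (simp add: h_def \<psi>(3))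
    also have "\<dots> = d (\<psi> (g z)) (g z)"
      by (metis g_inv iso)
    finally show "d (h z) z = k * d (g z) z" by (simp add: k(2))
  qed
  have iterate: "\<exists>h\<in>W. d (h z) z = k ^ n * d (g z) z" for n
  proof (induction n)
    case 0
    show ?case using g by (intro bexI[of _ g]) (auto simp: W_def)
  next
    case (Suc n)
    then show ?case using step by (metis mult.assoc power_Suc)
  qed
  have "d (g z) z \<le> 0"
  proof (rule ccontr)
    assume "\<not> d (g z) z \<le> 0"
    then have pos: "d (g z) z > 0" by linarith
    obtain n where "2 * d a z / d (g z) z < k ^ n"
      using k(1) real_arch_pow by blast
    then have "2 * d a z < k ^ n * d (g z) z" using pos by (simp add: field_simps)
    with iterate[of n] bounded show False by force
  qed
  then show ?thesis using nonneg[of "g z" z] zero[of "g z" z] by simp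
qed

text \<open>The function \<phi> is eliminated here, and continuity is reduced to boundedness near 0,
  the only form in which it enters.\<close>

locale reflective_equidistant_map =
  E: p_normed_space p NE + F: p_normed_space p NF
  for p and NE :: "'a::real_vector \<Rightarrow> real" and NF :: "'b::real_vector \<Rightarrow> real" +
  fixes T :: "'a \<Rightarrow> 'b"
  assumes T_zero: "T 0 = 0"
    and equidistant: "\<And>x y u v. NE (x - y) = NE (u - v) \<Longrightarrow> NF (T x - T y) = NF (T u - T v)"
    and locally_bounded: "\<exists>\<delta>>0. \<forall>x. NE x < \<delta> \<longrightarrow> NF (T x) < 1"
    and reflective: "\<And>x y. 2 *\<^sub>R T x - T y \<in> range T"
begin

section \<open>Boundedness on balls and injectivity\<close>

lemma equidistant_zero: "NE x = NE y \<Longrightarrow> NF (T x) = NF (T y)"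
  using equidistant[of x 0 y 0] by (simp add: T_zero)

lemma NF_T_diff: "NF (T x - T y) = NF (T (x - y))"
  using equidistant[of x y "x - y" 0] by (simp add: T_zero)

lemma NF_T_add_le: "NF (T (x + y)) \<le> NF (T x) + NF (T y)"
  using F.triangle[of "T (x + y) - T y" "T y"] by (simp add: NF_T_diff)

lemma NF_T_nat_scale_le: "NF (T (real n *\<^sub>R x)) \<le> real n * NF (T x)"
proof (induction n)
  case 0
  show ?case by (simp add: T_zero F.zero)
next
  case (Suc n)
  then show ?case
    using NF_T_add_le[of "real n *\<^sub>R x" x] by (simp add: algebra_simps)
qed

text \<open>A fixed fraction \<open>1 / n\<close> of the ball lies where \<open>T\<close> is bounded
  by 1; subadditivity returns to the ball at the cost of a factor \<open>n\<close>.\<close>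

lemma bounded_on_balls: "\<exists>B. \<forall>x. NE x \<le> r \<longrightarrow> NF (T x) \<le> B"
proof -
  obtain \<delta> where \<delta>: "\<delta> > 0" "\<And>x. NE x < \<delta> \<Longrightarrow> NF (T x) < 1"
    using locally_bounded by blast
  obtain n :: nat where n: "n > 0" "\<And>x. NE x \<le> r \<Longrightarrow> NE ((1 / real n) *\<^sub>R x) < \<delta>"
    using E.exists_small_fraction[OF \<delta>(1)] by blast
  have "NF (T x) \<le> real n" if "NE x \<le> r" for x
  proof -
    have "NF (T x) \<le> real n * NF (T ((1 / real n) *\<^sub>R x))"
      using NF_T_nat_scale_le[of n "(1 / real n) *\<^sub>R x"] n(1) by simp
    also have "\<dots> \<le> real n * 1"
      using \<delta>(2)[OF n(2)[OF that]] by (intro mult_left_mono) auto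
    finally show ?thesis by simp
  qed
  then show ?thesis by blast
qed

text \<open>Reflecting a multiple of \<open>T x\<close> at the next one yields the one after it, so
  the induction carries two consecutive multiples.\<close>

lemma nat_scale_mem_range: "real n *\<^sub>R T x \<in> range T"
proof -
  have "real n *\<^sub>R T x \<in> range T \<and> real (Suc n) *\<^sub>R T x \<in> range T"
  proof (induction n)
    case 0
    show ?case using T_zero by (metis of_nat_0 of_nat_1 One_nat_def rangeI scaleR_one scaleR_zero_left)
  next
    case (Suc n)
    then obtain y z where yz: "T y = real n *\<^sub>R T x" "T z = real (Suc n) *\<^sub>R T x"
      by (metis imageE)
    have "real (Suc (Suc n)) *\<^sub>R T x = 2 *\<^sub>R T z - T y"
      unfolding yz by (simp add: algebra_simps flip: scaleR_2)
    with Suc reflective[of z y] show ?case by metis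
  qed
  then show ?thesis ..
qed

lemma bounded_imp_zero:
  assumes "\<And>x. NF (T x) \<le> B"
  shows "T x = 0"
proof -
  have "real n powr p * NF (T x) \<le> B" for n :: nat
  proof -
    obtain y where "T y = real n *\<^sub>R T x" using nat_scale_mem_range by (metis imageE)
    with assms[of y] show ?thesis by (simp add: F.scale)
  qed
  then have "NF (T x) \<le> 0" by (rule nat_powr_mult_bounded_imp_nonpos[OF E.p_pos])
  then show ?thesis using F.nonneg[of "T x"] F.eq_zero_iff[of "T x"] by simp
qed

text \<open>If \<open>T\<close> vanishes at some \<open>u \<noteq> 0\<close>, it vanishes on the
  whole sphere of \<open>u\<close>, which meets every line through 0. Modulo such zeros each vector
  reduces into the ball of radius \<open>NE u\<close>, where \<open>T\<close> is bounded.\<close>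

lemma inj_or_zero: "inj T \<or> T = (\<lambda>x. 0)"
proof (cases "inj T")
  case False
  then obtain x y where xy: "T x = T y" "x \<noteq> y" by (auto simp: inj_def)
  define u where "u = x - y"
  have u: "u \<noteq> 0" "NF (T u) = 0"
    using xy NF_T_diff[of x y] by (auto simp: u_def F.zero)
  obtain B where B: "\<And>x. NE x \<le> NE u \<Longrightarrow> NF (T x) \<le> B"
    using bounded_on_balls[of "NE u"] by blast
  have "NF (T v) \<le> B" for v
  proof (cases "v = 0")
    case True
    then show ?thesis using B[of 0] E.nonneg[of u] by (simp add: E.zero)
  next
    case False
    obtain s where s: "s \<ge> 0" "NE (s *\<^sub>R v) = NE u"
      using E.exists_rescaling[OF False E.nonneg[of u]] by blast
    have "s \<noteq> 0" using s(2) u(1) by (metis E.eq_zero_iff scaleR_zero_left)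
    with s(1) have s0: "s > 0" by simp
    define w where "w = s *\<^sub>R v"
    have w: "NF (T w) = 0" using equidistant_zero[of w u] s(2) u(2) by (simp add: w_def)
    \<comment> \<open>As \<open>v\<close> is \<open>1 / s\<close> times \<open>w\<close>, the
      integer part \<open>m\<close> counts the copies of \<open>w\<close> to remove.\<close>
    define m where "m = nat \<lfloor>1 / s\<rfloor>"
    define r where "r = 1 / s - real m"
    have m: "real m = of_int \<lfloor>1 / s\<rfloor>" using s0 by (simp add: m_def)
    have r: "0 \<le> r" "r \<le> 1" unfolding r_def m by linarith+
    have "v = real m *\<^sub>R w + r *\<^sub>R w"
      using s0 by (simp add: w_def r_def field_simps flip: scaleR_add_left)
    then have "NF (T v) \<le> NF (T (real m *\<^sub>R w)) + NF (T (r *\<^sub>R w))"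
      using NF_T_add_le by metis
    also have "\<dots> \<le> NF (T (r *\<^sub>R w))"
      using NF_T_nat_scale_le[of m w] w by simp
    also have "\<dots> \<le> B"
    proof (rule B)
      have "r powr p \<le> 1 powr p" using r E.p_pos by (intro powr_mono2) auto
      then have "r powr p * NE w \<le> 1 * NE w"
        by (intro mult_right_mono) (auto simp: E.nonneg)
      then show "NE (r *\<^sub>R w) \<le> NE u" using r(1) s(2) by (simp only: E.scale[of r w] flip: w_def)
    qed
    finally show ?thesis .
  qed
  then show ?thesis using bounded_imp_zero by blast
qed simp

section \<open>Point reflections and additivity\<close>

lemma T_reflection: "T (2 *\<^sub>R c - x) = 2 *\<^sub>R T c - T x"
proof (cases "inj T")
  case False
  with inj_or_zero have "T = (\<lambda>x. 0)" by blast
  then show ?thesis by simp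
next
  case inj: True
  define d where "d = (\<lambda>x y. NF (T x - T y))"
  have metric: "Metric_space UNIV d"
  proof
    fix x y z
    show "0 \<le> d x y" by (simp add: d_def F.nonneg)
    show "d x y = d y x" by (simp add: d_def F.diff_commute)
    show "d x y = 0 \<longleftrightarrow> x = y" using inj by (auto simp: d_def F.eq_zero_iff inj_def)
    show "d x z \<le> d x y + d y z" using F.triangle[of "T x - T y" "T y - T z"] by (simp add: d_def)
  qed
  \<comment> \<open>The reflection of F at \<open>T c\<close>, pulled back along \<open>T\<close>;
    \<open>reflective\<close> keeps its argument in the range of \<open>T\<close>.\<close>
  define \<psi> where "\<psi> = (\<lambda>x. inv T (2 *\<^sub>R T c - T x))"
  have T\<psi>: "T (\<psi> x) = 2 *\<^sub>R T c - T x" for x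
    unfolding \<psi>_def using reflective by (rule f_inv_into_f)
  have \<psi>\<psi>: "\<psi> (\<psi> x) = x" for x
    using inj by (auto simp: T\<psi> intro!: injD[OF inj])
  have \<psi>c: "\<psi> c = c"
    by (rule injD[OF inj]) (simp add: T\<psi> scaleR_2)
  \<comment> \<open>The point reflection of E that swaps \<open>x\<close> and
    \<open>\<psi> x\<close>; it fixes \<open>c\<close> exactly when \<open>\<psi> x\<close> is
    \<open>2 *\<^sub>R c - x\<close>.\<close>
  define g where "g = (\<lambda>y. x + \<psi> x - y)"
  have "g c = c"
  proof (rule isometry_fixes_reflection_centre[where \<psi> = \<psi> and a = x and b = "\<psi> x"])
    show "Metric_space UNIV d" by (fact metric)
    show "bij \<psi>" by (rule involuntory_imp_bij) (fact \<psi>\<psi>)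
    show "d (\<psi> u) (\<psi> v) = d u v" for u v
      by (simp add: d_def T\<psi> F.diff_commute)
    show "\<psi> c = c" by (fact \<psi>c)
    show "\<psi> ` {x, \<psi> x} = {x, \<psi> x}" using \<psi>\<psi> by auto
    show "d x c = d (\<psi> x) c"
      by (simp add: d_def T\<psi> scaleR_2 F.diff_commute)
    have "(1::real) < 2 powr p" using E.p_pos by simp
    then show "1 < (2::real) powr p" .
    show "d (\<psi> u) u = 2 powr p * d u c" for u
    proof -
      have "T (\<psi> u) - T u = 2 *\<^sub>R (T c - T u)" by (simp add: T\<psi> algebra_simps scaleR_2)
      then have "d (\<psi> u) u = 2 powr p * d c u" by (simp add: d_def F.scale)
      then show ?thesis by (simp add: d_def F.diff_commute[of "T c"])
    qed
    show "bij g" by (rule involuntory_imp_bij) (simp add: g_def)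
    show "d (g u) (g v) = d u v" for u v
      unfolding d_def by (rule equidistant) (simp add: g_def E.diff_commute)
    show "g ` {x, \<psi> x} = {x, \<psi> x}" by (auto simp: g_def)
  qed
  then have "2 *\<^sub>R c - x = \<psi> x" by (simp add: g_def scaleR_2 algebra_simps)
  then show ?thesis by (simp add: T\<psi>)
qed

lemma T_minus: "T (- x) = - T x"
  using T_reflection[of 0 x] by (simp add: T_zero)

text \<open>The sum is the reflection of \<open>- y\<close> at half of \<open>x\<close>.\<close>

lemma T_add: "T (x + y) = T x + T y"
proof -
  have "T (x + y) = 2 *\<^sub>R T ((1/2) *\<^sub>R x) + T y"
    using T_reflection[of "(1/2) *\<^sub>R x" "- y"] by (simp add: T_minus)
  also have "2 *\<^sub>R T ((1/2) *\<^sub>R x) = T x"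
    using T_reflection[of "(1/2) *\<^sub>R x" 0] by (simp add: T_zero)
  finally show ?thesis .
qed

section \<open>Real homogeneity and the isometry\<close>

lemma T_nat_scale: "T (real n *\<^sub>R x) = real n *\<^sub>R T x"
  by (induction n) (simp_all add: T_zero T_add scaleR_add_left)

lemma T_int_scale: "T (real_of_int m *\<^sub>R x) = real_of_int m *\<^sub>R T x"
  by (cases m rule: int_cases2) (simp_all add: T_nat_scale T_minus)

text \<open>
  The defect \<open>T (s x) - s T x\<close> is additive and 1-periodic in \<open>s\<close>, hence bounded, hence zero.
\<close>
lemma T_scale: "T (s *\<^sub>R x) = s *\<^sub>R T x"
proof -
  define f where "f = (\<lambda>s. T (s *\<^sub>R x) - s *\<^sub>R T x)"
  obtain B where B: "\<And>y. NE y \<le> NE x \<Longrightarrow> NF (T y) \<le> B"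
    using bounded_on_balls by blast
  have bounded: "NF (f s) \<le> B + NF (T x)" for s
  proof -
    define r where "r = frac s"
    have r: "0 \<le> r" "r \<le> 1" by (auto simp: r_def frac_lt_1 less_imp_le)
    have rp: "r powr p \<le> 1" using r E.p_pos powr_mono2[of p r 1] by simp
    have le: "r powr p * a \<le> a" if "a \<ge> 0" for a
      using mult_right_mono[OF rp that] by simp
    have s: "s = r + of_int \<lfloor>s\<rfloor>" by (simp add: r_def frac_def)
    have "f s = f r"
      unfolding f_def by (subst (1 2) s) (simp add: scaleR_add_left T_add T_int_scale)
    then have "NF (f s) \<le> NF (T (r *\<^sub>R x)) + NF (r *\<^sub>R T x)"
      using F.triangle[of "T (r *\<^sub>R x)" "- (r *\<^sub>R T x)"] by (simp add: f_def F.minus)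
    also have "\<dots> \<le> B + NF (T x)"
      using r le[of "NE x"] le[of "NF (T x)"]
      by (intro add_mono B) (auto simp: E.scale F.scale E.nonneg F.nonneg)
    finally show ?thesis .
  qed
  have "real n powr p * NF (f s) \<le> B + NF (T x)" for n :: nat
  proof -
    have "f (real n * s) = real n *\<^sub>R f s"
      using T_nat_scale[of n "s *\<^sub>R x"] by (simp add: f_def scaleR_diff_right)
    with bounded[of "real n * s"] show ?thesis by (simp add: F.scale)
  qed
  then have "NF (f s) \<le> 0" by (rule nat_powr_mult_bounded_imp_nonpos[OF E.p_pos])
  then have "f s = 0" using F.nonneg[of "f s"] F.eq_zero_iff[of "f s"] by simp
  then show ?thesis by (simp add: f_def)
qed

lemma linear_T: "linear T"
  by (rule linearI) (fact T_add T_scale)+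

text \<open>A multiple of \<open>x\<close> lies on the sphere of \<open>y\<close>, and both p-norms
  scale by the same factor along it.\<close>

lemma NF_T_proportional:
  assumes "x \<noteq> 0"
  shows "NF (T y) = NF (T x) / NE x * NE y"
proof -
  obtain s where s: "s \<ge> 0" "s powr p = NE y / NE x" "NE (s *\<^sub>R x) = NE y"
    using E.exists_rescaling[OF assms E.nonneg[of y]] by blast
  have "NF (T y) = NF (T (s *\<^sub>R x))" using equidistant_zero s(3) by metis
  then show ?thesis using s(1,2) by (simp add: T_scale F.scale)
qed

lemma scalar_times_isometry:
  assumes "T \<noteq> (\<lambda>x. 0)"
  shows "\<exists>\<beta> V. is_isometry NE NF V \<and> T = (\<lambda>x. \<beta> *\<^sub>R V x)"
proof -
  obtain x where x: "T x \<noteq> 0" using assms by auto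
  then have x0: "x \<noteq> 0" using T_zero by auto
  define K where "K = NF (T x) / NE x"
  have K: "K > 0"
    using x x0 E.nonneg[of x] F.nonneg[of "T x"] E.eq_zero_iff[of x] F.eq_zero_iff[of "T x"]
    by (simp add: K_def)
  \<comment> \<open>The p-th root, because a scalar enters \<open>NF\<close> through its p-th
    power.\<close>
  define \<beta> where "\<beta> = K powr (1/p)"
  have \<beta>: "\<beta> > 0" "\<beta> powr p = K"
    using K E.p_pos by (auto simp: \<beta>_def powr_powr)
  define V where "V = (\<lambda>x. (1 / \<beta>) *\<^sub>R T x)"
  have "NF (V y - V z) = NE (y - z)" for y z
  proof -
    have "NF (V y - V z) = NF (T (y - z)) / K"
      using \<beta> by (simp add: V_def F.scale NF_T_diff powr_divide flip: scaleR_diff_right)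
    then show ?thesis
      using NF_T_proportional[OF x0, of "y - z"] K by (simp flip: K_def)
  qed
  then have "is_isometry NE NF V" by (simp add: is_isometry_def)
  moreover have "T = (\<lambda>x. \<beta> *\<^sub>R V x)" using \<beta>(1) by (simp add: V_def)
  ultimately show ?thesis by blast
qed

end

theorem corollary2p3:
  fixes p :: real
    and NE :: "'a::real_vector \<Rightarrow> real"
    and NF :: "'b::real_vector \<Rightarrow> real"
    and T :: "'a \<Rightarrow> 'b"
  assumes "p_normed_space p NE"
    and "p_normed_space p NF"
    and "continuous_map (norm_topology NE) (norm_topology NF) T"
    and "T 0 = 0"
    and "preserves_equality_of_distance NE NF T"
    and "\<And>x y. 2 *\<^sub>R T x - T y \<in> range T"
  shows "linear T \<and>
         (T \<noteq> (\<lambda>x. 0) \<longrightarrow> (\<exists>(\<beta>::real) V. is_isometry NE NF V \<and> T = (\<lambda>x. \<beta> *\<^sub>R V x)))"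
proof -
  interpret E: p_normed_space p NE by fact
  interpret F: p_normed_space p NF by fact
  interpret EM: Metric_space UNIV "norm_dist NE" by (rule E.Metric_space_norm_dist)
  have "reflective_equidistant_map p NE NF T"
  proof
    show "T 0 = 0" by fact
    show "NF (T x - T y) = NF (T u - T v)" if "NE (x - y) = NE (u - v)" for x y u v
      using assms(5) that by (auto simp: preserves_equality_of_distance_def)
    obtain \<delta> where \<delta>: "\<delta> > 0" "\<And>y. norm_dist NE 0 y < \<delta> \<Longrightarrow> norm_dist NF (T 0) (T y) < 1"
      using EM.continuous_at_pointD[OF F.Metric_space_norm_dist
          assms(3)[unfolded norm_topology_def], of 0 1]
      by auto
    then show "\<exists>\<delta>>0. \<forall>x. NE x < \<delta> \<longrightarrow> NF (T x) < 1"
      by (intro exI[of _ \<delta>]) (simp add: norm_dist_def assms(4) E.minus F.minus)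
    show "2 *\<^sub>R T x - T y \<in> range T" for x y by fact
  qed
  then interpret reflective_equidistant_map p NE NF T .
  show ?thesis using linear_T scalar_times_isometry by blast
qed

end
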